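(* If $t,l$ are positive integers, then the elementary symmetric polynomial $X(2^t,\,2^{t+1}l-1)$ over $GF(2)$ is balanced.
   Context: For integers $1\le d\le n$, $X(d,n)=\sum_{1\le i_1<i_2<\cdots<i_d\le n}x_{i_1}x_{i_2}\cdots x_{i_d}$ is the elementary symmetric polynomial of degree $d$ in $n$ variables over $GF(2)$, viewed as a function $GF(2)^n\to GF(2)$. A function $f:GF(2)^n\to GF(2)$ is balanced if it takes each of the values $0$ and $1$ exactly $2^{n-1}$ times. *)

theory Defs
  imports Main "HOL-Library.FuncSet" "HOL-Library.Z2"
begin

text \<open>
  The type \<^typ>\<open>bit\<close> is the field with two elements. Since the dimension \<open>n\<close> is a natural
  number that varies, a point of the \<open>n\<close>-dimensional space over it is an extensional function
  on the index set \<open>{1..n}\<close>, so that each point has exactly one representative.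
\<close>

definition gf2_space :: "nat \<Rightarrow> (nat \<Rightarrow> bit) set" where
  "gf2_space n = ({1..n} \<rightarrow>\<^sub>E (UNIV :: bit set))"

text \<open>
  Strictly increasing index sequences \<open>1 \<le> i\<^sub>1 < \<dots> < i\<^sub>d \<le> n\<close> correspond
  to the \<open>d\<close>-element subsets of \<open>{1..n}\<close>.
\<close>

definition elem_sym :: "nat \<Rightarrow> nat \<Rightarrow> (nat \<Rightarrow> bit) \<Rightarrow> bit" where
  "elem_sym d n x = (\<Sum>S | S \<subseteq> {1..n} \<and> card S = d. \<Prod>i\<in>S. x i)"

text \<open>Meaningful for \<open>n \<ge> 1\<close> only, because of the truncated subtraction.\<close>

definition balanced :: "nat \<Rightarrow> ((nat \<Rightarrow> bit) \<Rightarrow> bit) \<Rightarrow> bool" where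
  "balanced n f \<longleftrightarrow>
     card {x \<in> gf2_space n. f x = 0} = 2 ^ (n - 1) \<and>
     card {x \<in> gf2_space n. f x = 1} = 2 ^ (n - 1)"

end

theory Submission
  imports Defs
begin

text \<open>
  At a point of weight \<open>w\<close> the polynomial takes the value \<open>w choose 2 ^ t\<close> mod 2, which is the
  binary digit of \<open>w\<close> at position \<open>t\<close>. As the \<open>t + 1\<close> lowest binary digits of
  \<open>n = 2 ^ (t + 1) * l - 1\<close> are all 1, passing from \<open>w\<close> to \<open>n - w\<close> flips this digit, so that
  complementing all coordinates exchanges the two fibres.
\<close>

text \<open>By absorption, \<open>k * (2 ^ t choose k)\<close> is a multiple of
  \<open>2 ^ t\<close>; were the binomial odd, \<open>2 ^ t\<close> would divide the smaller
  positive number \<open>k\<close>.\<close>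

lemma even_choose_power_of_2:
  assumes "0 < k" "k < 2 ^ t"
  shows "even (2 ^ t choose k)"
proof (rule ccontr)
  assume odd: "odd (2 ^ t choose k)"
  have "k * (2 ^ t choose k) = 2 ^ t * ((2 ^ t - 1) choose (k - 1))"
    using times_binomial_minus1_eq[of k "2 ^ t"] assms by simp
  then have "2 ^ t dvd k * (2 ^ t choose k)"
    by simp
  with odd have "2 ^ t dvd k"
    by (simp add: coprime_dvd_mult_left_iff)
  with assms show False
    by (auto dest: dvd_imp_le)
qed

text \<open>A special case of Lucas's theorem. Adding \<open>2 ^ t\<close> to the upper index flips
  both sides: modulo 2 only the two extreme terms of the Vandermonde convolution survive.\<close>

lemma odd_choose_power_of_2_iff:
  "odd (w choose 2 ^ t) \<longleftrightarrow> odd (w div 2 ^ t)"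
proof (induction w rule: less_induct)
  case (less w)
  show ?case
  proof (cases "w < 2 ^ t")
    case True
    then show ?thesis by (simp add: binomial_eq_0)
  next
    case False
    then obtain v where w: "w = v + 2 ^ t"
      by (metis add.commute le_add_diff_inverse not_less)
    let ?g = "\<lambda>k. (2 ^ t choose k) * (v choose (2 ^ t - k))"
    have "w choose 2 ^ t = (\<Sum>k\<le>2 ^ t. ?g k)"
      using vandermonde[of "2 ^ t" v "2 ^ t"] by (simp add: w add.commute)
    also have "{..2 ^ t} = {0, 2 ^ t} \<union> {0<..<2 ^ t :: nat}"
      by auto
    also have "(\<Sum>k\<in>\<dots>. ?g k) = (\<Sum>k\<in>{0, 2 ^ t}. ?g k) + (\<Sum>k\<in>{0<..<2 ^ t}. ?g k)"
      by (rule sum.union_disjoint) auto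
    \<comment> \<open>The indices 0 and \<open>2 ^ t\<close> are distinct even for
      \<open>t = 0\<close>; they contribute \<open>v choose 2 ^ t\<close> and 1
      respectively.\<close>
    also have "(\<Sum>k\<in>{0, 2 ^ t}. ?g k) = (v choose 2 ^ t) + 1"
      by simp
    finally have "w choose 2 ^ t = (v choose 2 ^ t) + 1 + (\<Sum>k\<in>{0<..<2 ^ t}. ?g k)" .
    moreover have "even (\<Sum>k\<in>{0<..<2 ^ t}. ?g k)"
      by (rule dvd_sum) (simp add: even_choose_power_of_2)
    ultimately have "odd (w choose 2 ^ t) \<longleftrightarrow> even (v choose 2 ^ t)"
      by simp
    also have "\<dots> \<longleftrightarrow> even (v div 2 ^ t)"
      using less.IH[of v] w by simp
    also have "\<dots> \<longleftrightarrow> odd (w div 2 ^ t)"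
      by (simp add: w div_add_self2)
    finally show ?thesis .
  qed
qed

lemma of_nat_bit_eq_0_iff: "(of_nat m :: bit) = 0 \<longleftrightarrow> even m"
  by (induction m) auto

text \<open>A monomial has value 1 if its index set lies in the support of \<open>x\<close> and 0
  otherwise, so the sum counts the \<open>d\<close>-subsets of the support.\<close>

lemma elem_sym_eq_choose:
  "elem_sym d n x = of_nat (card {i \<in> {1..n}. x i = 1} choose d)"
proof -
  let ?W = "{i \<in> {1..n}. x i = 1}"
  have "elem_sym d n x = (\<Sum>S | S \<subseteq> ?W \<and> card S = d. \<Prod>i\<in>S. x i)"
    unfolding elem_sym_def
  proof (rule sum.mono_neutral_right)
    show "\<forall>S\<in>{S. S \<subseteq> {1..n} \<and> card S = d} - {S. S \<subseteq> ?W \<and> card S = d}. (\<Prod>i\<in>S. x i) = 0"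
    proof
      fix S assume S: "S \<in> {S. S \<subseteq> {1..n} \<and> card S = d} - {S. S \<subseteq> ?W \<and> card S = d}"
      then have "finite S" by (auto intro: finite_subset)
      moreover from S obtain i where "i \<in> S" "x i \<noteq> 1" by blast
      then have "i \<in> S" "x i = 0" by simp_all
      ultimately show "(\<Prod>i\<in>S. x i) = 0" by (auto intro: prod_zero)
    qed
  qed auto
  also have "\<dots> = (\<Sum>S | S \<subseteq> ?W \<and> card S = d. 1)"
    by (intro sum.cong prod.neutral) auto
  also have "\<dots> = of_nat (card ?W choose d)"
    by (simp add: n_subsets)
  finally show ?thesis .
qed

lemma odd_div_complement_iff:
  fixes l t w :: nat
  assumes "w \<le> 2 ^ (t + 1) * l - 1" "l \<ge> 1"
  shows "odd ((2 ^ (t + 1) * l - 1 - w) div 2 ^ t) \<longleftrightarrow> even (w div 2 ^ t)"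
proof -
  define p q r where "p = (2 ^ t :: nat)" and "q = w div p" and "r = w mod p"
  have w: "w = p * q + r" and r: "r < p"
    by (simp_all add: p_def q_def r_def)
  \<comment> \<open>Positivity of the product makes the truncated \<open>- 1\<close> exact, so the
    bound on \<open>w\<close> becomes strict.\<close>
  have "w < p * (2 * l)"
  proof -
    have "p * (2 * l) > 0"
      using assms(2) by (simp add: p_def)
    moreover have "w \<le> p * (2 * l) - 1"
      using assms(1) by (simp add: p_def ac_simps)
    ultimately show ?thesis
      by linarith
  qed
  then have "q < 2 * l"
    by (simp add: q_def less_mult_imp_div_less mult.commute)
  \<comment> \<open>This \<open>m\<close> is the quotient of the complementary weight: removing
    \<open>p * q + r\<close> from \<open>p * (2 * l) - 1\<close> leaves \<open>m\<close> full blocks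
    of size \<open>p\<close> and the remainder \<open>p - 1 - r\<close>. Since \<open>q + m\<close>
    is odd, the parities of \<open>q\<close> and \<open>m\<close> differ.\<close>
  then obtain m where m: "2 * l = q + m + 1"
    by (metis Suc_eq_plus1 add_Suc_right less_iff_Suc_add)
  have "2 ^ (t + 1) * l = p * (q + m + 1)"
    unfolding m[symmetric] by (simp add: p_def)
  then have "2 ^ (t + 1) * l - 1 - w = p * m + (p - 1 - r)"
    using r by (simp add: w algebra_simps)
  moreover have "(p * m + (p - 1 - r)) div p = m"
    using r by (intro div_nat_eqI) auto
  ultimately have "(2 ^ (t + 1) * l - 1 - w) div p = m"
    by simp
  moreover have "odd m \<longleftrightarrow> even q"
    using m by presburger
  ultimately show ?thesis
    by (simp add: p_def q_def)
qed

text \<open>The restricted abstraction keeps the value outside \<open>{1..n}\<close> undefined, so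
  the result is again an extensional point.\<close>

definition complement :: "nat \<Rightarrow> (nat \<Rightarrow> bit) \<Rightarrow> nat \<Rightarrow> bit" where
  "complement n x = (\<lambda>i\<in>{1..n}. x i + 1)"

lemma complement_in_gf2_space: "complement n x \<in> gf2_space n"
  by (simp add: complement_def gf2_space_def)

lemma complement_complement:
  "x \<in> gf2_space n \<Longrightarrow> complement n (complement n x) = x"
  by (auto simp: complement_def gf2_space_def fun_eq_iff PiE_def extensional_def add.assoc)

lemma weight_complement:
  "card {i \<in> {1..n}. complement n x i = 1} = n - card {i \<in> {1..n}. x i = 1}"
proof -
  have "{i \<in> {1..n}. complement n x i = 1} = {1..n} - {i \<in> {1..n}. x i = 1}"
    by (auto simp: complement_def)
  moreover have "card ({1..n} - {i \<in> {1..n}. x i = 1}) = card {1..n} - card {i \<in> {1..n}. x i = 1}"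
    by (rule card_Diff_subset) auto
  ultimately show ?thesis
    by simp
qed

lemma card_gf2_space: "card (gf2_space n) = 2 ^ n"
proof -
  have "(UNIV :: bit set) = {0, 1}"
    by auto
  then have "card (UNIV :: bit set) = card {0, 1 :: bit}"
    by (rule arg_cong)
  then have "card (UNIV :: bit set) = 2"
    by simp
  then show ?thesis
    by (simp add: gf2_space_def card_PiE)
qed

text \<open>Complementation is an involution of the space, so it matches the two fibres bijectively;
  being disjoint and covering the space, each is half of it.\<close>

lemma balanced_if_complement_flips:
  assumes "n \<ge> 1"
    and flip: "\<And>x. x \<in> gf2_space n \<Longrightarrow> f (complement n x) \<noteq> f x"
  shows "balanced n f"
proof -
  let ?A = "\<lambda>b. {x \<in> gf2_space n. f x = b}"
  \<comment> \<open>An infinite set would have cardinality 0 by convention, whereas here it is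
    \<open>2 ^ n\<close>.\<close>
  have fin: "finite (gf2_space n)"
    by (rule card_ge_0_finite) (simp add: card_gf2_space)
  have flip': "f (complement n x) = f x + 1" if "x \<in> gf2_space n" for x
    using flip[OF that] by (cases "f x"; cases "f (complement n x)") auto
  have "bij_betw (complement n) (?A 0) (?A 1)"
    by (rule bij_betw_byWitness[where f' = "complement n"])
      (auto simp: complement_complement complement_in_gf2_space flip')
  then have eq: "card (?A 0) = card (?A 1)"
    by (rule bij_betw_same_card)
  have "gf2_space n = ?A 0 \<union> ?A 1"
    by auto
  then have "2 ^ n = card (?A 0 \<union> ?A 1)"
    by (metis card_gf2_space)
  also have "\<dots> = card (?A 0) + card (?A 1)"
    using fin by (intro card_Un_disjoint) auto
  \<comment> \<open>Splitting off a factor 2 relies on \<open>n \<ge> 1\<close>, where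
    \<open>n - 1\<close> is not truncated.\<close>
  finally have "2 * 2 ^ (n - 1) = card (?A 0) + card (?A 1)"
    using assms(1) by (simp flip: power_Suc)
  with eq show ?thesis
    by (simp add: balanced_def)
qed

theorem theorem4:
  fixes t l :: nat
  assumes "t \<ge> 1" and "l \<ge> 1"
  shows "balanced (2 ^ (t + 1) * l - 1) (elem_sym (2 ^ t) (2 ^ (t + 1) * l - 1))"
proof (rule balanced_if_complement_flips)
  let ?n = "2 ^ (t + 1) * l - 1"
  have "2 * 1 * 1 \<le> 2 * 2 ^ t * l"
    using assms(2) by (intro mult_le_mono) auto
  then show "?n \<ge> 1"
    unfolding power_add power_one_right mult.commute[of "2 ^ t" 2] by linarith
  fix x :: "nat \<Rightarrow> bit"
  let ?w = "card {i \<in> {1..?n}. x i = 1}"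
  have "?w \<le> card {1..?n}"
    by (rule card_mono) auto
  then have "?w \<le> ?n"
    by simp
  \<comment> \<open>Both binomials are read as digits at position \<open>t\<close>, and these digits
    are opposite.\<close>
  then have "odd ((?n - ?w) choose 2 ^ t) \<longleftrightarrow> even (?w choose 2 ^ t)"
    using odd_div_complement_iff[OF _ assms(2), of ?w t]
      odd_choose_power_of_2_iff[of "?n - ?w" t] odd_choose_power_of_2_iff[of ?w t]
    by argo
  then have "of_nat ((?n - ?w) choose 2 ^ t) \<noteq> (of_nat (?w choose 2 ^ t) :: bit)"
    using of_nat_bit_eq_0_iff[of "(?n - ?w) choose 2 ^ t"] of_nat_bit_eq_0_iff[of "?w choose 2 ^ t"]
    by argo
  then show "elem_sym (2 ^ t) ?n (complement ?n x) \<noteq> elem_sym (2 ^ t) ?n x"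
    unfolding elem_sym_eq_choose weight_complement .
qed

end
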